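(* For each integer $n\geq 1$, there is a $C_2$-equivariant immersion $$\mathbb{P}(n\rho)\looparrowright 2^{\phi(2n-1)}\rho,$$ where, for a positive integer $k$, $\phi(k)$ denotes the number of integers $s$ such that $0<s\leq k$ and $s\equiv 0,1,2,4 \pmod 8$.
   Context: $C_2$ is the cyclic group of order two, $\sigma$ its real sign representation, and $\rho=1+\sigma$ its (real) regular representation; $N\rho$ denotes the direct sum of $N$ copies of $\rho$. $\mathbb{P}(n\rho):=S(n\rho)/\text{antipodes}$ is the projectivization of $n\rho$, i.e. the quotient of the unit sphere $S(n\rho)$ by the antipodal map, with its residual $C_2$-action; it is a smooth closed $C_2$-manifold of dimension $2n-1$ with underlying manifold $\mathbb{RP}^{2n-1}$. A $C_2$-equivariant immersion of a smooth $C_2$-manifold $M$ into a representation $V$ is a smooth $C_2$-equivariant map $M\to V$ whose differential is injective at each point. *)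

theory Defs
  imports "HOL-Analysis.Analysis"
begin

section \<open>Smooth maps between Euclidean spaces\<close>

text \<open>Meant for open domains only, since the derivatives are the two-sided ones.
  For a finite-dimensional domain, continuity of all directional derivatives of the
  \<open>k\<close>-th order is continuity of the \<open>k\<close>-th Frechet derivative.\<close>

primrec Ck_on :: "nat \<Rightarrow> 'a::euclidean_space set \<Rightarrow> ('a \<Rightarrow> 'b::real_normed_vector) \<Rightarrow> bool" where
  "Ck_on 0 S f \<longleftrightarrow> continuous_on S f"
| "Ck_on (Suc k) S f \<longleftrightarrow> (\<forall>x\<in>S. f differentiable (at x)) \<and>
     (\<forall>v. Ck_on k S (\<lambda>x. frechet_derivative f (at x) v))"

definition smooth_on :: "'a::euclidean_space set \<Rightarrow> ('a \<Rightarrow> 'b::real_normed_vector) \<Rightarrow> bool" where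
  "smooth_on S f \<longleftrightarrow> (\<forall>k. Ck_on k S f)"

section \<open>Smooth manifolds with an action of the group of order two\<close>

text \<open>Manifolds are presented by atlases of charts \<open>(U, \<phi>)\<close>, with \<open>\<phi>\<close> a bijection from
  \<open>U\<close> to an open subset of a Euclidean space; the topology on the underlying set is the one
  determined by the atlas. An action of the group of order two is given by the involution
  by which the generator acts.\<close>

type_synonym ('p, 'e) chart = "'p set \<times> ('p \<Rightarrow> 'e)"

definition smooth_atlas :: "'p set \<Rightarrow> ('p, 'e::euclidean_space) chart set \<Rightarrow> bool" where
  "smooth_atlas M \<A> \<longleftrightarrow>
     (\<Union>(U, \<phi>)\<in>\<A>. U) = M \<and>
     (\<forall>(U, \<phi>)\<in>\<A>. inj_on \<phi> U \<and> open (\<phi> ` U)) \<and>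
     (\<forall>(U, \<phi>)\<in>\<A>. \<forall>(V, \<psi>)\<in>\<A>.
        open (\<phi> ` (U \<inter> V)) \<and> smooth_on (\<phi> ` (U \<inter> V)) (\<psi> \<circ> inv_into U \<phi>))"

definition smooth_C2_manifold ::
    "'p set \<Rightarrow> ('p, 'e::euclidean_space) chart set \<Rightarrow> ('p \<Rightarrow> 'p) \<Rightarrow> bool" where
  "smooth_C2_manifold M \<A> g \<longleftrightarrow>
     smooth_atlas M \<A> \<and>
     (\<forall>p\<in>M. g p \<in> M \<and> g (g p) = p) \<and>
     (\<forall>(U, \<phi>)\<in>\<A>. \<forall>(V, \<psi>)\<in>\<A>.
        open (\<phi> ` (U \<inter> g -` V)) \<and>
        smooth_on (\<phi> ` (U \<inter> g -` V)) (\<psi> \<circ> g \<circ> inv_into U \<phi>))"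

definition C2_representation :: "('v::euclidean_space \<Rightarrow> 'v) \<Rightarrow> bool" where
  "C2_representation \<tau> \<longleftrightarrow> linear \<tau> \<and> (\<forall>x. \<tau> (\<tau> x) = x)"

text \<open>Smoothness and the differential of a map into a vector space, read in the charts.\<close>

definition immersion_into ::
    "('p, 'e::euclidean_space) chart set \<Rightarrow> ('p \<Rightarrow> 'v::euclidean_space) \<Rightarrow> bool" where
  "immersion_into \<A> f \<longleftrightarrow>
     (\<forall>(U, \<phi>)\<in>\<A>. smooth_on (\<phi> ` U) (f \<circ> inv_into U \<phi>) \<and>
        (\<forall>p\<in>U. inj (frechet_derivative (f \<circ> inv_into U \<phi>) (at (\<phi> p)))))"

definition C2_immersion ::
    "'p set \<Rightarrow> ('p, 'e::euclidean_space) chart set \<Rightarrow> ('p \<Rightarrow> 'p) \<Rightarrow>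
     ('v::euclidean_space \<Rightarrow> 'v) \<Rightarrow> ('p \<Rightarrow> 'v) \<Rightarrow> bool" where
  "C2_immersion M \<A> g \<tau> f \<longleftrightarrow>
     smooth_C2_manifold M \<A> g \<and> C2_representation \<tau> \<and>
     immersion_into \<A> f \<and> (\<forall>p\<in>M. f (g p) = \<tau> (f p))"

section \<open>Multiples of the regular representation\<close>

text \<open>The first summand of \<open>real \<times> real\<close> is the trivial representation and the second one is
  the sign representation. The norm on \<open>'n nrho\<close> is the usual Euclidean one.\<close>

type_synonym 'n nrho = "(real \<times> real) ^ 'n"

definition rho_act :: "real \<times> real \<Rightarrow> real \<times> real" where
  "rho_act z = (fst z, - snd z)"

definition nrho_act :: "'n::finite nrho \<Rightarrow> 'n nrho" where
  "nrho_act x = (\<chi> i. rho_act (x $ i))"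

section \<open>The projectivization of a representation\<close>

definition antipodes :: "'v::euclidean_space \<Rightarrow> 'v set" where
  "antipodes x = {x, - x}"

definition proj_space :: "'v::euclidean_space set set" where
  "proj_space = antipodes ` sphere 0 1"

definition proj_act :: "('v \<Rightarrow> 'v) \<Rightarrow> 'v set \<Rightarrow> 'v set" where
  "proj_act \<tau> p = \<tau> ` p"

text \<open>Each linear isomorphism \<open>A\<close> from \<open>real \<times> 'e\<close> gives linear coordinates \<open>(t, y)\<close> and hence
  the affine chart \<open>[A (t, y)] \<mapsto> y / t\<close> on the set of lines with \<open>t \<noteq> 0\<close>. Its inverse is the
  following map, where \<open>sgn u\<close> is the unit vector in the direction of \<open>u\<close>. The atlas is empty
  unless the dimension of \<open>'v\<close> exceeds that of \<open>'e\<close> by one.\<close>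

definition affine_param ::
    "(real \<times> 'e::euclidean_space \<Rightarrow> 'v::euclidean_space) \<Rightarrow> 'e \<Rightarrow> 'v set" where
  "affine_param A y = antipodes (sgn (A (1, y)))"

definition proj_atlas :: "('v::euclidean_space set, 'e::euclidean_space) chart set" where
  "proj_atlas = {(range (affine_param A), inv (affine_param A)) | A. linear A \<and> bij A}"

section \<open>The exponent\<close>

definition phi :: "nat \<Rightarrow> nat" where
  "phi k = card {s. 0 < s \<and> s \<le> k \<and> s mod 8 \<in> {0, 1, 2, 4}}"

section \<open>Basic facts\<close>

subsection \<open>Smooth maps\<close>

lemma Ck_on_SucI:
  fixes f :: "'a::euclidean_space \<Rightarrow> 'b::real_normed_vector"
  assumes "\<And>x. x \<in> S \<Longrightarrow> (f has_derivative D x) (at x)"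
    and "\<And>v. Ck_on k S (\<lambda>x. D x v)" and "open S"
    and cong: "\<And>g h :: 'a \<Rightarrow> 'b.
      (\<And>x. x \<in> S \<Longrightarrow> g x = h x) \<Longrightarrow> Ck_on k S g \<Longrightarrow> Ck_on k S h"
  shows "Ck_on (Suc k) S f"
proof -
  have "Ck_on k S (\<lambda>x. frechet_derivative f (at x) v)" for v
    by (rule cong[OF _ assms(2)[of v]]) (simp add: frechet_derivative_at[OF assms(1), symmetric])
  then show ?thesis using assms(1) by (auto simp: differentiable_def)
qed

lemma Ck_on_cong:
  fixes f g :: "'a::euclidean_space \<Rightarrow> 'b::real_normed_vector"
  assumes "open S" "\<And>x. x \<in> S \<Longrightarrow> f x = g x" "Ck_on k S f"
  shows "Ck_on k S g"
  using assms(2,3)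
proof (induction k arbitrary: f g)
  case 0
  then show ?case by (metis Ck_on.simps(1) continuous_on_cong)
next
  case (Suc k)
  show ?case
  proof (rule Ck_on_SucI[OF _ _ assms(1)])
    fix x assume x: "x \<in> S"
    have "(f has_derivative frechet_derivative f (at x)) (at x)"
      using Suc.prems x frechet_derivative_works by auto
    then show "(g has_derivative frechet_derivative f (at x)) (at x)"
      using has_derivative_transform_within_open[OF _ assms(1) x] Suc.prems(1) by blast
  next
    show "Ck_on k S (\<lambda>x. frechet_derivative f (at x) v)" for v
      using Suc.prems by simp
  qed (use Suc.IH in blast)
qed

lemma Ck_on_SucI':
  assumes "open S" "\<And>x. x \<in> S \<Longrightarrow> (f has_derivative D x) (at x)"
    and "\<And>v. Ck_on k S (\<lambda>x. D x v)"
  shows "Ck_on (Suc k) S f"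
  using Ck_on_SucI[OF assms(2,3,1)] Ck_on_cong[OF assms(1)] by blast

lemma Ck_on_Suc_imp: "open S \<Longrightarrow> Ck_on (Suc k) S f \<Longrightarrow> Ck_on k S f"
proof (induction k arbitrary: f)
  case 0
  then show ?case
    by (auto intro!: continuous_at_imp_continuous_on differentiable_imp_continuous_within)
next
  case (Suc k)
  then show ?case by (metis Ck_on.simps(2))
qed

lemma Ck_on_const: "Ck_on k S (\<lambda>x. c)"
  by (induction k arbitrary: c) auto

lemma Ck_on_bounded_linear:
  assumes "open S" "bounded_linear f" shows "Ck_on k S (\<lambda>x. c + f x)"
proof (cases k)
  case 0
  then show ?thesis
    using assms by (simp add: continuous_on_add linear_continuous_on)
next
  case (Suc m)
  have "((\<lambda>x. c + f x) has_derivative f) (at x)" for x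
    using bounded_linear_imp_has_derivative[OF assms(2)] by (auto intro!: derivative_eq_intros)
  then show ?thesis
    unfolding Suc by (intro Ck_on_SucI'[OF assms(1)]) (auto intro: Ck_on_const)
qed

lemma Ck_on_add:
  assumes "open S" "Ck_on k S f" "Ck_on k S g"
  shows "Ck_on k S (\<lambda>x. f x + g x)"
  using assms(2,3)
proof (induction k arbitrary: f g)
  case 0
  then show ?case by (auto intro: continuous_intros)
next
  case (Suc k)
  show ?case
  proof (rule Ck_on_SucI'[OF assms(1)])
    fix x assume "x \<in> S"
    then show "((\<lambda>x. f x + g x) has_derivative
      (\<lambda>v. frechet_derivative f (at x) v + frechet_derivative g (at x) v)) (at x)"
      using Suc.prems by (intro has_derivative_add) (auto simp flip: frechet_derivative_works)
  qed (use Suc in auto)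
qed

lemma Ck_on_scaleR:
  fixes a :: "'a::euclidean_space \<Rightarrow> real"
  assumes "open S" "Ck_on k S a" "Ck_on k S f"
  shows "Ck_on k S (\<lambda>x. a x *\<^sub>R f x)"
  using assms(2,3)
proof (induction k arbitrary: a f)
  case 0
  then show ?case by (auto intro: continuous_intros)
next
  case (Suc k)
  show ?case
  proof (rule Ck_on_SucI'[OF assms(1)])
    fix x assume "x \<in> S"
    then show "((\<lambda>x. a x *\<^sub>R f x) has_derivative
      (\<lambda>v. a x *\<^sub>R frechet_derivative f (at x) v + frechet_derivative a (at x) v *\<^sub>R f x)) (at x)"
      using Suc.prems by (intro has_derivative_scaleR) (auto simp flip: frechet_derivative_works)
  next
    show "Ck_on k S (\<lambda>x. a x *\<^sub>R frechet_derivative f (at x) v + frechet_derivative a (at x) v *\<^sub>R f x)"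
      for v
      by (intro Ck_on_add Suc.IH assms(1) Ck_on_Suc_imp[OF assms(1) Suc.prems(1)]
          Ck_on_Suc_imp[OF assms(1) Suc.prems(2)]) (use Suc.prems in auto)
  qed
qed

lemma Ck_on_inverse:
  fixes a :: "'a::euclidean_space \<Rightarrow> real"
  assumes "open S" "Ck_on k S a" "\<And>x. x \<in> S \<Longrightarrow> a x \<noteq> 0"
  shows "Ck_on k S (\<lambda>x. inverse (a x))"
  using assms(2)
proof (induction k)
  case 0
  then show ?case using assms(3) by (auto intro!: continuous_intros)
next
  case (Suc k)
  have i: "Ck_on k S (\<lambda>x. inverse (a x))"
    using Suc Ck_on_Suc_imp[OF assms(1)] by blast
  show ?case
  proof (rule Ck_on_SucI'[OF assms(1)])
    fix x assume "x \<in> S"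
    then have "a x \<noteq> 0" "(a has_derivative frechet_derivative a (at x)) (at x)"
      using assms(3) Suc.prems by (auto simp flip: frechet_derivative_works)
    then show "((\<lambda>x. inverse (a x)) has_derivative
      (\<lambda>v. (- 1) *\<^sub>R (inverse (a x) *\<^sub>R (frechet_derivative a (at x) v *\<^sub>R inverse (a x))))) (at x)"
      by (auto intro!: derivative_eq_intros)
  next
    show "Ck_on k S (\<lambda>x. (- 1) *\<^sub>R (inverse (a x) *\<^sub>R (frechet_derivative a (at x) v *\<^sub>R inverse (a x))))"
      for v
      by (intro Ck_on_scaleR assms(1) i Ck_on_const) (use Suc.prems in auto)
  qed
qed

subsection \<open>Affine charts of the projectivization\<close>

lemma antipodes_sgn_eq_iff:
  assumes "u \<noteq> 0" "w \<noteq> 0"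
  shows "antipodes (sgn u) = antipodes (sgn w) \<longleftrightarrow> (\<exists>c. c \<noteq> 0 \<and> u = c *\<^sub>R w)"
proof
  assume "antipodes (sgn u) = antipodes (sgn w)"
  then have "sgn u = sgn w \<or> sgn u = - sgn w"
    by (auto simp: antipodes_def doubleton_eq_iff)
  moreover have "u = norm u *\<^sub>R sgn u" using assms by (simp add: sgn_div_norm)
  ultimately have "u = norm u *\<^sub>R sgn w \<or> u = (- norm u) *\<^sub>R sgn w" by auto
  then have "u = (norm u / norm w) *\<^sub>R w \<or> u = (- norm u / norm w) *\<^sub>R w"
    by (simp add: sgn_div_norm divide_inverse)
  moreover have "norm u / norm w \<noteq> 0" "- norm u / norm w \<noteq> 0" using assms by auto
  ultimately show "\<exists>c. c \<noteq> 0 \<and> u = c *\<^sub>R w" by blast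
next
  assume "\<exists>c. c \<noteq> 0 \<and> u = c *\<^sub>R w"
  then obtain c where c: "c \<noteq> 0" "u = c *\<^sub>R w" by blast
  then have "sgn u = sgn w \<or> sgn u = - sgn w"
    by (auto simp: sgn_scaleR sgn_if)
  then show "antipodes (sgn u) = antipodes (sgn w)"
    by (auto simp: antipodes_def)
qed

lemma affine_arg_nonzero:
  fixes A :: "real \<times> 'e::euclidean_space \<Rightarrow> 'v::euclidean_space"
  assumes "linear A" "bij A" shows "A (1, y) \<noteq> 0"
proof
  assume "A (1, y) = 0"
  then have "A (1, y) = A 0" using assms by (simp add: linear_0)
  then have "(1::real, y) = 0" using assms(2) by (simp add: bij_is_inj inj_eq)
  then show False by (simp add: zero_prod_def)
qed

lemma linear_inv_of_bij:
  fixes A :: "'a::euclidean_space \<Rightarrow> 'b::euclidean_space"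
  assumes "linear A" "bij A" shows "linear (inv A)"
proof -
  have "A (inv A x) = x" for x using assms(2) by (simp add: bij_is_surj surj_f_inv_f)
  moreover have "inv A (A x) = x" for x using assms(2) by (simp add: bij_is_inj)
  ultimately show ?thesis
    by (intro linearI) (metis linear_add[OF assms(1)], metis linear_scale[OF assms(1)])
qed

lemma affine_param_eq_iff:
  fixes A B :: "real \<times> 'e::euclidean_space \<Rightarrow> 'v::euclidean_space"
  assumes "linear A" "bij A" "linear B" "bij B"
  shows "affine_param A y = affine_param B z \<longleftrightarrow>
    fst (inv B (A (1, y))) \<noteq> 0 \<and>
    z = inverse (fst (inv B (A (1, y)))) *\<^sub>R snd (inv B (A (1, y)))"
proof -
  define w where "w = inv B (A (1, y))"
  have Bw: "A (1, y) = B w"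
    by (metis assms(4) bij_inv_eq_iff w_def)
  have "affine_param A y = affine_param B z \<longleftrightarrow> (\<exists>c. c \<noteq> 0 \<and> B w = c *\<^sub>R B (1, z))"
    using antipodes_sgn_eq_iff[OF affine_arg_nonzero[OF assms(1,2)] affine_arg_nonzero[OF assms(3,4)]]
    by (simp add: affine_param_def flip: Bw)
  also have "\<dots> \<longleftrightarrow> (\<exists>c. c \<noteq> 0 \<and> w = c *\<^sub>R (1, z))"
    using assms(3,4) by (metis linear_scale bij_is_inj injD)
  also have "\<dots> \<longleftrightarrow> fst w \<noteq> 0 \<and> z = inverse (fst w) *\<^sub>R snd w"
    by (cases w) auto
  finally show ?thesis unfolding w_def .
qed

lemma inj_affine_param:
  assumes "linear A" "bij A" shows "inj (affine_param A)"
proof (rule injI)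
  fix y z assume "affine_param A y = affine_param A z"
  then show "y = z"
    using affine_param_eq_iff[OF assms assms, of y z] assms(2) by (simp add: bij_is_inj)
qed

lemma inv_into_chart:
  assumes "inj f" shows "inv_into (range f) (inv f) = f"
proof
  fix y
  have "inj_on (inv f) (range f)" by (simp add: inj_on_inv_into)
  then show "inv_into (range f) (inv f) y = f y"
    by (metis assms inv_f_f inv_into_f_eq rangeI)
qed

lemma affine_transition:
  fixes A B :: "real \<times> 'e::euclidean_space \<Rightarrow> 'v::euclidean_space"
  assumes "linear A" "bij A" "linear B" "bij B"
  defines "S \<equiv> {y. affine_param A y \<in> range (affine_param B)}"
  shows "open S" "smooth_on S (\<lambda>y. inv (affine_param B) (affine_param A y))"
proof -
  define L where "L y = inv B (A (0, y))" for y
  define c where "c = inv B (A (1, 0))"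
  have lin: "linear (inv B \<circ> A)"
    using assms linear_inv_of_bij linear_compose by blast
  have eq: "inv B (A (1, y)) = c + L y" for y
    using linear_add[OF lin, of "(1, 0)" "(0, y)"] by (simp add: c_def L_def)
  have "linear (\<lambda>y::'e. (0::real, y))" by (simp add: linear_iff)
  from linear_compose[OF this lin] have "linear L" by (simp add: L_def[abs_def] o_def)
  then have L: "bounded_linear L" by (simp add: linear_conv_bounded_linear)
  have S: "S = {y. fst (c + L y) \<noteq> 0}"
    unfolding S_def image_def using affine_param_eq_iff[OF assms(1-4)] eq by auto
  have "continuous_on UNIV (\<lambda>y. fst (c + L y))"
    by (intro continuous_on_fst continuous_on_add continuous_on_const linear_continuous_on[OF L])
  then have "open ((\<lambda>y. fst (c + L y)) -` (- {0}))"
    by (rule open_vimage[rotated]) (rule open_Compl[OF closed_singleton])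
  then show o: "open S" unfolding S by (simp add: vimage_def)
  have t: "inverse (fst c + fst (L y)) *\<^sub>R (snd c + snd (L y)) =
      inv (affine_param B) (affine_param A y)" if "y \<in> S" for y
  proof -
    have "affine_param A y =
        affine_param B (inverse (fst c + fst (L y)) *\<^sub>R (snd c + snd (L y)))"
      using that unfolding affine_param_eq_iff[OF assms(1-4)] eq S by simp
    then show ?thesis by (simp add: inv_f_f[OF inj_affine_param[OF assms(3,4)]])
  qed
  have c: "Ck_on k S (\<lambda>y. inverse (fst c + fst (L y)) *\<^sub>R (snd c + snd (L y)))" for k
    by (intro Ck_on_scaleR Ck_on_inverse Ck_on_bounded_linear o
        bounded_linear_compose[OF bounded_linear_fst L] bounded_linear_compose[OF bounded_linear_snd L])
      (simp add: S)
  have "Ck_on k S (\<lambda>y. inv (affine_param B) (affine_param A y))" for k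
    by (rule Ck_on_cong[OF o _ c[of k]]) (rule t)
  then show "smooth_on S (\<lambda>y. inv (affine_param B) (affine_param A y))"
    by (simp add: smooth_on_def)
qed

lemma affine_param_in_proj_space:
  assumes "linear A" "bij A" shows "affine_param A y \<in> proj_space"
  using affine_arg_nonzero[OF assms] by (auto simp: affine_param_def proj_space_def norm_sgn)

lemma affine_param_surj:
  fixes x :: "'v::euclidean_space"
  assumes "DIM('v) = Suc DIM('e::euclidean_space)" "norm x = 1"
  shows "\<exists>A :: real \<times> 'e \<Rightarrow> 'v. linear A \<and> bij A \<and> affine_param A 0 = antipodes x"
proof -
  have "DIM(real \<times> 'e) = DIM('v)" using assms(1) by simp
  then obtain T :: "real \<times> 'e \<Rightarrow> 'v" and T' where T: "linear T" "linear T'"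
    "\<And>x. norm (T x) = norm x" "\<And>y. norm (T' y) = norm y" "\<And>x. T' (T x) = x" "\<And>y. T (T' y) = y"
    using isomorphisms_UNIV_UNIV by blast
  define e where "e = T (1, 0)"
  define d where "d = e - x"
  define R where "R z = z - (2 * (z \<bullet> d) / (d \<bullet> d)) *\<^sub>R d" for z
  have ne: "norm e = 1" by (simp add: e_def T norm_Pair)
  have "linear R"
    unfolding R_def
    by (intro linear_compose_sub linear_ident) (auto intro!: linearI simp: inner_add_left
        add_divide_distrib scaleR_add_left distrib_left)
  have RR: "R (R z) = z" for z
  proof (cases "d = 0")
    case False
    then have "R z \<bullet> d = - (z \<bullet> d)" by (simp add: R_def inner_diff_left)
    then have "R (R z) = R z + (2 * (z \<bullet> d) / (d \<bullet> d)) *\<^sub>R d" by (simp add: R_def[of "R z"])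
    then show ?thesis by (simp add: R_def)
  qed (simp add: R_def)
  have Re: "R e = x"
  proof (cases "d = 0")
    case True then show ?thesis by (simp add: R_def) (simp add: d_def)
  next
    case False
    have "e \<bullet> e = 1" "x \<bullet> x = 1"
      using ne assms(2) by (simp_all add: dot_square_norm)
    then have "2 * (e \<bullet> d) = d \<bullet> d"
      by (simp add: d_def inner_diff_left inner_diff_right inner_commute)
    then show ?thesis using False by (simp add: R_def) (simp add: d_def)
  qed
  have "bij R" using RR by (metis bijI')
  moreover have "bij T" using T by (metis bijI')
  ultimately have "bij (R \<circ> T)" using bij_comp by blast
  moreover have "linear (R \<circ> T)" using T \<open>linear R\<close> linear_compose by blast
  moreover have "affine_param (R \<circ> T) 0 = antipodes x"
    using Re assms(2) by (simp add: affine_param_def e_def sgn_div_norm)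
  ultimately show ?thesis by blast
qed

lemma chart_image:
  assumes "inj f" shows "inv f ` (range f \<inter> g -` V) = {y. g (f y) \<in> V}"
proof -
  have "range f \<inter> g -` V = f ` {y. g (f y) \<in> V}" by auto
  then show ?thesis using assms by (simp add: image_image)
qed

lemma smooth_atlas_proj_atlas:
  assumes "DIM('v::euclidean_space) = Suc DIM('e::euclidean_space)"
  shows "smooth_atlas proj_space (proj_atlas :: ('v set, 'e) chart set)"
proof -
  have 1: "(\<Union>(U, \<phi>)\<in>(proj_atlas :: ('v set, 'e) chart set). U) = proj_space"
  proof (intro equalityI subsetI)
    fix p assume "p \<in> (\<Union>(U, \<phi>)\<in>(proj_atlas :: ('v set, 'e) chart set). U)"
    then show "p \<in> proj_space"
      using affine_param_in_proj_space by (auto simp: proj_atlas_def)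
  next
    fix p :: "'v set" assume "p \<in> proj_space"
    then obtain x where "norm x = 1" "p = antipodes x" by (auto simp: proj_space_def)
    then obtain A :: "real \<times> 'e \<Rightarrow> 'v" where "linear A" "bij A" "p = affine_param A 0"
      using affine_param_surj[OF assms] by metis
    then show "p \<in> (\<Union>(U, \<phi>)\<in>(proj_atlas :: ('v set, 'e) chart set). U)"
      unfolding proj_atlas_def by blast
  qed
  have 2: "inj_on (inv f) (range f) \<and> open (inv f ` range f)"
    if "inj f" for f :: "'e \<Rightarrow> 'v set"
    using that by (auto simp: inj_on_inv_into image_image)
  have 3: "open (inv (affine_param A) ` (range (affine_param A) \<inter> range (affine_param B))) \<and>
      smooth_on (inv (affine_param A) ` (range (affine_param A) \<inter> range (affine_param B)))
        (inv (affine_param B) \<circ> inv_into (range (affine_param A)) (inv (affine_param A)))"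
    if "linear A" "bij A" "linear B" "bij B" for A B :: "real \<times> 'e \<Rightarrow> 'v"
    using affine_transition[OF that] inj_affine_param[OF that(1,2)]
      chart_image[OF inj_affine_param[OF that(1,2)], where g = "\<lambda>p. p"]
    by (simp add: inv_into_chart o_def)
  show ?thesis
    unfolding smooth_atlas_def
  proof (intro conjI 1)
    show "\<forall>(U, \<phi>)\<in>(proj_atlas :: ('v set, 'e) chart set). inj_on \<phi> U \<and> open (\<phi> ` U)"
      using 2 inj_affine_param unfolding proj_atlas_def by blast
  qed (use 3 in \<open>simp add: proj_atlas_def, blast\<close>)
qed

lemma smooth_C2_manifold_proj_space:
  fixes \<tau> :: "'v::euclidean_space \<Rightarrow> 'v"
  assumes "DIM('v) = Suc DIM('e::euclidean_space)"
    and "C2_representation \<tau>" "\<And>x. norm (\<tau> x) = norm x"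
  shows "smooth_C2_manifold proj_space (proj_atlas :: ('v set, 'e) chart set) (proj_act \<tau>)"
proof -
  have lin: "linear \<tau>" and inv: "\<tau> (\<tau> x) = x" for x
    using assms(2) by (auto simp: C2_representation_def)
  have bij: "bij \<tau>" using inv by (metis bijI')
  have ant: "proj_act \<tau> (antipodes x) = antipodes (\<tau> x)" for x
    by (simp add: proj_act_def antipodes_def linear_neg[OF lin])
  have sgn: "\<tau> (sgn x) = sgn (\<tau> x)" for x
    by (simp add: sgn_div_norm linear_scale[OF lin] assms(3))
  have act: "proj_act \<tau> (affine_param A y) = affine_param (\<tau> \<circ> A) y"
    for A :: "real \<times> 'e \<Rightarrow> 'v" and y
    by (simp add: affine_param_def ant sgn)
  have 1: "proj_act \<tau> p \<in> proj_space \<and> proj_act \<tau> (proj_act \<tau> p) = p" if "p \<in> proj_space" for p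
    using that assms(3) by (auto simp: proj_space_def ant inv)
  have 2: "open (inv (affine_param A) ` (range (affine_param A) \<inter> proj_act \<tau> -` range (affine_param B))) \<and>
      smooth_on (inv (affine_param A) ` (range (affine_param A) \<inter> proj_act \<tau> -` range (affine_param B)))
        (inv (affine_param B) \<circ> proj_act \<tau> \<circ> inv_into (range (affine_param A)) (inv (affine_param A)))"
    if "linear A" "bij A" "linear B" "bij B" for A B :: "real \<times> 'e \<Rightarrow> 'v"
  proof -
    have "linear (\<tau> \<circ> A)" "bij (\<tau> \<circ> A)"
      using that lin bij linear_compose bij_comp by blast+
    from affine_transition[OF this that(3,4)] show ?thesis
      by (simp add: chart_image inj_affine_param inv_into_chart that o_def act[unfolded o_def])
  qed
  show ?thesis
    unfolding smooth_C2_manifold_def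
  proof (intro conjI)
    show "smooth_atlas proj_space (proj_atlas :: ('v set, 'e) chart set)"
      by (rule smooth_atlas_proj_atlas[OF assms(1)])
    show "\<forall>p\<in>proj_space. proj_act \<tau> p \<in> proj_space \<and> proj_act \<tau> (proj_act \<tau> p) = p"
      using 1 by blast
  qed (use 2 in \<open>simp add: proj_atlas_def, blast\<close>)
qed

subsection \<open>The action on multiples of the regular representation\<close>

lemma C2_representation_nrho_act: "C2_representation nrho_act"
  unfolding C2_representation_def
  by (auto intro!: linearI simp: nrho_act_def rho_act_def vec_eq_iff prod_eq_iff)

lemma norm_nrho_act: "norm (nrho_act x) = norm x"
  by (simp add: nrho_act_def rho_act_def norm_vec_def norm_prod_def)

lemma smooth_C2_manifold_P_nrho:
  assumes "CARD('k::finite) = 2 * CARD('n::finite) - 1"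
  shows "smooth_C2_manifold proj_space (proj_atlas :: ('n nrho set, real ^ 'k) chart set)
    (proj_act nrho_act)"
proof (rule smooth_C2_manifold_proj_space)
  have "0 < CARD('n)" by simp
  then show "DIM('n nrho) = Suc DIM(real ^ 'k)" using assms by simp
qed (rule C2_representation_nrho_act norm_nrho_act)+

end

theory Submission
  imports Defs "HOL-Computational_Algebra.Polynomial"
begin

text \<open>Let \<open>B : V \<times> V \<rightarrow> W\<close> be a symmetric bilinear map without zero divisors. Squaring unit
  vectors, \<open>[x] \<mapsto> B x x\<close>, is well defined on the projective space of \<open>V\<close> because antipodal
  vectors have the same square. It is an immersion: the tangent space at \<open>[x]\<close> is the
  orthogonal complement of \<open>x\<close>, and there the differential \<open>w \<mapsto> 2 B x w\<close> is injective since
  \<open>x\<close> is not a zero divisor. It is equivariant as soon as \<open>B\<close> is. Hopf used this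
  construction to embed projective spaces.

  For \<open>V = n\<rho>\<close> such a \<open>B\<close> is multiplication of polynomials. Identify \<open>n\<rho>\<close> with the real
  polynomials of degree less than \<open>2n\<close>, the involution being the substitution of \<open>- t\<close> for
  \<open>t\<close>: the even powers of \<open>t\<close> span the trivial summands and the odd powers the sign
  summands. Products have degree at most \<open>4n - 2\<close>, so they lie in \<open>m\<rho>\<close> whenever
  \<open>2n \<le> m\<close>. Lemmas \<open>C2_immersion_proj_square\<close> and \<open>nrho_mult_nonsingular\<close> carry these two
  steps.

  For \<open>m = 2^\<phi>(2n - 1)\<close> the bound \<open>2n \<le> m\<close> always holds. As \<open>\<phi>\<close> grows by four over each
  period of length eight, replacing \<open>n\<close> by \<open>n + 4\<close> multiplies \<open>m\<close> by \<open>16\<close>, so the cases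
  \<open>n = 1, 2, 3, 4\<close> suffice; there \<open>m = 2, 4, 8, 8\<close>, with equality for \<open>n = 1, 2, 4\<close>.\<close>

section \<open>Immersions of projective spaces by squaring\<close>

lemma Ck_on_bounded_bilinear:
  assumes "bounded_bilinear P" "open S" "Ck_on k S f" "Ck_on k S g"
  shows "Ck_on k S (\<lambda>x. P (f x) (g x))"
  using assms(3,4)
proof (induction k arbitrary: f g)
  case 0
  then show ?case by (auto intro: bounded_bilinear.continuous_on[OF assms(1)])
next
  case (Suc k)
  show ?case
  proof (rule Ck_on_SucI'[OF assms(2)])
    fix x assume "x \<in> S"
    then show "((\<lambda>x. P (f x) (g x)) has_derivative
      (\<lambda>v. P (f x) (frechet_derivative g (at x) v) + P (frechet_derivative f (at x) v) (g x))) (at x)"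
      using Suc.prems
      by (intro bounded_bilinear.FDERIV[OF assms(1)]) (auto simp flip: frechet_derivative_works)
  next
    show "Ck_on k S (\<lambda>x. P (f x) (frechet_derivative g (at x) v) + P (frechet_derivative f (at x) v) (g x))"
      for v
      by (intro Ck_on_add Suc.IH assms(2) Ck_on_Suc_imp[OF assms(2) Suc.prems(1)]
          Ck_on_Suc_imp[OF assms(2) Suc.prems(2)]) (use Suc.prems in auto)
  qed
qed

definition proj_square :: "('v \<Rightarrow> 'v \<Rightarrow> 'w) \<Rightarrow> 'v::euclidean_space set \<Rightarrow> 'w::euclidean_space" where
  "proj_square B p = (let x = SOME x. x \<in> p in B x x)"

lemma proj_square_antipodes:
  assumes "bilinear B"
  shows "proj_square B (antipodes x) = B x x"
proof -
  have "(SOME y. y \<in> antipodes x) \<in> antipodes x"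
    by (rule someI[of _ x]) (simp add: antipodes_def)
  then have "(SOME y. y \<in> antipodes x) = x \<or> (SOME y. y \<in> antipodes x) = - x"
    by (auto simp: antipodes_def)
  then show ?thesis
    by (auto simp: proj_square_def Let_def bilinear_lneg[OF assms] bilinear_rneg[OF assms])
qed

lemma proj_square_affine_param:
  fixes A :: "real \<times> 'e::euclidean_space \<Rightarrow> 'v::euclidean_space"
  assumes "bilinear B"
  shows "proj_square B (affine_param A y) =
    inverse (A (1, y) \<bullet> A (1, y)) *\<^sub>R B (A (1, y)) (A (1, y))"
proof -
  have "inverse (norm x) * inverse (norm x) = inverse (x \<bullet> x)" for x :: 'v
    by (simp add: dot_square_norm power2_eq_square)
  then show ?thesis
    unfolding affine_param_def proj_square_antipodes[OF assms]
    by (simp add: sgn_div_norm bilinear_lmul[OF assms] bilinear_rmul[OF assms])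
qed

text \<open>At \<open>x = A (1, y)\<close> the differential of \<open>B x x / (x \<bullet> x)\<close> in the direction \<open>w = A (0, v)\<close>
  is \<open>2 B x w' / (x \<bullet> x)\<close>, where \<open>w'\<close> is the component of \<open>w\<close> orthogonal to \<open>x\<close>. If it
  vanishes, so does \<open>w'\<close>; then \<open>A (0, v)\<close> is a multiple of \<open>A (1, y)\<close>, which forces \<open>v = 0\<close>.\<close>

lemma inj_derivative_normalized_square:
  fixes A :: "real \<times> 'e::euclidean_space \<Rightarrow> 'v::euclidean_space"
    and B :: "'v \<Rightarrow> 'v \<Rightarrow> 'w::euclidean_space"
  assumes A: "linear A" "bij A"
    and B: "bilinear B" "\<And>x y. B x y = B y x" "\<And>x y. B x y = 0 \<Longrightarrow> x = 0 \<or> y = 0"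
  shows "inj (frechet_derivative
    (\<lambda>y. inverse (A (1, y) \<bullet> A (1, y)) *\<^sub>R B (A (1, y)) (A (1, y))) (at y))"
    (is "inj (frechet_derivative ?h (at y))")
proof -
  define u where "u = A (1, y)"
  have u0: "u \<noteq> 0" unfolding u_def by (rule affine_arg_nonzero[OF A])
  have bb: "bounded_bilinear B"
    using B(1) bilinear_conv_bounded_bilinear by blast
  have blA: "bounded_linear A" using A(1) by (simp add: linear_conv_bounded_linear)
  have dA: "((\<lambda>y. A (1, y)) has_derivative (\<lambda>v. A (0, v))) (at y)"
    by (rule bounded_linear.has_derivative[OF blA]) (auto intro!: derivative_eq_intros)
  have dB: "((\<lambda>y. B (A (1, y)) (A (1, y))) has_derivative
      (\<lambda>v. B u (A (0, v)) + B (A (0, v)) u)) (at y)"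
    unfolding u_def by (rule bounded_bilinear.FDERIV[OF bb dA dA])
  have dI: "((\<lambda>y. A (1, y) \<bullet> A (1, y)) has_derivative
      (\<lambda>v. u \<bullet> A (0, v) + A (0, v) \<bullet> u)) (at y)"
    unfolding u_def by (rule has_derivative_inner[OF dA dA])
  have "((\<lambda>y. inverse (A (1, y) \<bullet> A (1, y))) has_derivative
      (\<lambda>v. - (inverse (u \<bullet> u) * (u \<bullet> A (0, v) + A (0, v) \<bullet> u) * inverse (u \<bullet> u)))) (at y)"
    unfolding u_def
    by (rule Deriv.has_derivative_inverse[OF _ dI[unfolded u_def]]) (use u0 in \<open>simp add: u_def\<close>)
  from has_derivative_scaleR[OF this dB]
  have d: "(?h has_derivative (\<lambda>v. inverse (u \<bullet> u) *\<^sub>R (B u (A (0, v)) + B (A (0, v)) u) +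
      (- (inverse (u \<bullet> u) * (u \<bullet> A (0, v) + A (0, v) \<bullet> u) * inverse (u \<bullet> u))) *\<^sub>R B u u)) (at y)"
    (is "(_ has_derivative ?D) _")
    by (simp add: u_def)
  have D: "?D v = (2 * inverse (u \<bullet> u)) *\<^sub>R B u (A (0, v) - ((u \<bullet> A (0, v)) / (u \<bullet> u)) *\<^sub>R u)" for v
    unfolding B(2)[of "A (0, v)" u] inner_commute[of "A (0, v)" u]
      bilinear_rsub[OF B(1)] bilinear_rmul[OF B(1)]
    by (simp add: algebra_simps divide_inverse flip: scaleR_2)
  have "v = 0" if "?D v = 0" for v
  proof -
    from that have "B u (A (0, v) - ((u \<bullet> A (0, v)) / (u \<bullet> u)) *\<^sub>R u) = 0"
      using u0 unfolding D by simp
    from B(3)[OF this] u0 have "A (0, v) = ((u \<bullet> A (0, v)) / (u \<bullet> u)) *\<^sub>R u" by simp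
    also have "\<dots> = A (((u \<bullet> A (0, v)) / (u \<bullet> u)) *\<^sub>R (1, y))"
      unfolding u_def by (rule linear_scale[OF A(1), symmetric])
    finally have "(0::real, v) = ((u \<bullet> A (0, v)) / (u \<bullet> u)) *\<^sub>R (1, y)"
      by (rule injD[OF bij_is_inj[OF A(2)]])
    then show "v = 0" by (auto simp: prod_eq_iff)
  qed
  then have "inj ?D"
    using linear_injective_0[OF has_derivative_linear[OF d]] by simp
  then show ?thesis by (simp add: frechet_derivative_at[OF d, symmetric])
qed

theorem C2_immersion_proj_square:
  fixes B :: "'v::euclidean_space \<Rightarrow> 'v \<Rightarrow> 'w::euclidean_space"
  assumes dim: "DIM('v) = Suc DIM('e::euclidean_space)"
    and \<tau>: "C2_representation \<tau>" "\<And>x. norm (\<tau> x) = norm x" and \<upsilon>: "C2_representation \<upsilon>"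
    and B: "bilinear B" "\<And>x y. B x y = B y x" "\<And>x y. B x y = 0 \<Longrightarrow> x = 0 \<or> y = 0"
    and equivariant: "\<And>x y. B (\<tau> x) (\<tau> y) = \<upsilon> (B x y)"
  shows "C2_immersion proj_space (proj_atlas :: ('v set, 'e) chart set) (proj_act \<tau>) \<upsilon>
    (proj_square B)"
proof -
  have lin: "linear \<tau>" using \<tau> by (simp add: C2_representation_def)
  have act: "proj_square B (proj_act \<tau> p) = \<upsilon> (proj_square B p)" if "p \<in> proj_space" for p
  proof -
    from that obtain x where "p = antipodes x" by (auto simp: proj_space_def)
    moreover have "proj_act \<tau> (antipodes x) = antipodes (\<tau> x)"
      by (simp add: proj_act_def antipodes_def linear_neg[OF lin])
    ultimately show ?thesis by (simp add: proj_square_antipodes[OF B(1)] equivariant)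
  qed
  have chart: "smooth_on (inv (affine_param A) ` range (affine_param A))
        (proj_square B \<circ> inv_into (range (affine_param A)) (inv (affine_param A))) \<and>
      (\<forall>p\<in>range (affine_param A). inj (frechet_derivative
        (proj_square B \<circ> inv_into (range (affine_param A)) (inv (affine_param A)))
        (at (inv (affine_param A) p))))"
    if A: "linear A" "bij A" for A :: "real \<times> 'e \<Rightarrow> 'v"
  proof -
    let ?h = "\<lambda>y. inverse (A (1, y) \<bullet> A (1, y)) *\<^sub>R B (A (1, y)) (A (1, y))"
    have h: "proj_square B \<circ> inv_into (range (affine_param A)) (inv (affine_param A)) = ?h"
      by (simp add: fun_eq_iff inv_into_chart[OF inj_affine_param[OF A]]
          proj_square_affine_param[OF B(1)])
    have img: "inv (affine_param A) ` range (affine_param A) = UNIV"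
      by (simp add: image_image inv_f_f[OF inj_affine_param[OF A]])
    have "linear (\<lambda>y::'e. (0::real, y))" by (simp add: linear_iff)
    from linear_compose[OF this A(1)] have "bounded_linear (\<lambda>y. A (0, y))"
      by (simp add: o_def linear_conv_bounded_linear)
    then have "Ck_on k UNIV (\<lambda>y. A (1, 0) + A (0, y))" for k
      by (intro Ck_on_bounded_linear) auto
    moreover have "A (1, 0) + A (0, y) = A (1, y)" for y
      using linear_add[OF A(1), of "(1, 0)" "(0, y)"] by simp
    ultimately have u: "Ck_on k UNIV (\<lambda>y. A (1, y))" for k by simp
    have "Ck_on k UNIV ?h" for k
      by (intro Ck_on_scaleR Ck_on_inverse u open_UNIV
          Ck_on_bounded_bilinear[OF bounded_bilinear_inner]
          Ck_on_bounded_bilinear[OF B(1)[unfolded bilinear_conv_bounded_bilinear]])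
        (simp add: affine_arg_nonzero[OF A])
    then show ?thesis
      unfolding h img smooth_on_def
      using inj_derivative_normalized_square[OF A B] by blast
  qed
  have "immersion_into (proj_atlas :: ('v set, 'e) chart set) (proj_square B)"
    using chart by (auto simp only: immersion_into_def proj_atlas_def mem_Collect_eq case_prod_conv)
  then show ?thesis
    unfolding C2_immersion_def
    using smooth_C2_manifold_proj_space[OF dim \<tau>] \<upsilon> act by blast
qed

section \<open>Multiples of the regular representation as spaces of polynomials\<close>

text \<open>The coordinate with index \<open>i\<close> contributes \<open>(a + b t) t^(2i)\<close>; an enumeration \<open>e\<close> of the
  index type gives the numbers \<open>i\<close>. Conversely, a polynomial is read modulo high powers of \<open>t\<close>.\<close>

definition nrho_poly :: "('n \<Rightarrow> nat) \<Rightarrow> 'n::finite nrho \<Rightarrow> real poly" where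
  "nrho_poly e x = (\<Sum>i\<in>UNIV. monom (fst (x $ i)) (2 * e i) + monom (snd (x $ i)) (2 * e i + 1))"

definition poly_nrho :: "('m \<Rightarrow> nat) \<Rightarrow> real poly \<Rightarrow> 'm::finite nrho" where
  "poly_nrho e p = (\<chi> i. (coeff p (2 * e i), coeff p (2 * e i + 1)))"

definition nrho_mult :: "('n \<Rightarrow> nat) \<Rightarrow> ('m \<Rightarrow> nat) \<Rightarrow> 'n::finite nrho \<Rightarrow> 'n nrho \<Rightarrow> 'm::finite nrho"
  where "nrho_mult e h x y = poly_nrho h (nrho_poly e x * nrho_poly e y)"

lemma poly_nrho_nrho_poly:
  assumes "inj e" shows "poly_nrho e (nrho_poly e x) = x"
proof -
  have "2 * e i \<noteq> Suc (2 * e j)" "Suc (2 * e j) \<noteq> 2 * e i" for i j by presburger+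
  then show ?thesis
    by (simp add: poly_nrho_def nrho_poly_def vec_eq_iff prod_eq_iff coeff_sum inj_eq[OF assms]
        sum.delta')
qed

lemma nrho_poly_add: "nrho_poly e (x + y) = nrho_poly e x + nrho_poly e y"
  by (simp add: nrho_poly_def add_monom[symmetric] sum.distrib algebra_simps)

lemma smult_sum_right: "smult c (sum f S) = (\<Sum>i\<in>S. smult c (f i))"
  by (induction S rule: infinite_finite_induct) (simp_all add: smult_add_right)

lemma nrho_poly_scaleR: "nrho_poly e (c *\<^sub>R x) = smult c (nrho_poly e x)"
  by (simp add: nrho_poly_def smult_sum_right smult_add_right smult_monom)

lemma linear_poly_nrho:
  "poly_nrho e (p + q) = poly_nrho e p + poly_nrho e q"
  "poly_nrho e (smult c p) = c *\<^sub>R poly_nrho e p"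
  by (simp_all add: poly_nrho_def vec_eq_iff)

lemma bilinear_nrho_mult: "bilinear (nrho_mult e h)"
  unfolding bilinear_def nrho_mult_def
  by (auto intro!: linearI simp: nrho_poly_add nrho_poly_scaleR linear_poly_nrho
      distrib_left distrib_right)

lemma nrho_poly_nrho_act: "nrho_poly e (nrho_act x) = pcompose (nrho_poly e x) [:0, -1:]"
  by (simp add: nrho_poly_def nrho_act_def rho_act_def poly_eq_iff coeff_pcompose_linear coeff_sum
      sum_distrib_left distrib_left) (auto intro!: sum.cong)

lemma poly_nrho_pcompose: "poly_nrho e (pcompose p [:0, -1:]) = nrho_act (poly_nrho e p)"
  by (simp add: poly_nrho_def nrho_act_def rho_act_def vec_eq_iff coeff_pcompose_linear)

lemma nrho_mult_equivariant:
  "nrho_mult e h (nrho_act x) (nrho_act y) = nrho_act (nrho_mult e h x y)"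
  by (simp add: nrho_mult_def nrho_poly_nrho_act poly_nrho_pcompose flip: pcompose_mult)

lemma degree_nrho_poly:
  fixes e :: "'n::finite \<Rightarrow> nat"
  assumes "\<And>i. e i < n"
  shows "degree (nrho_poly e x) \<le> 2 * n - 1"
  unfolding nrho_poly_def
proof (intro degree_sum_le finite degree_add_le)
  fix i
  show "degree (monom (fst (x $ i)) (2 * e i)) \<le> 2 * n - 1"
    "degree (monom (snd (x $ i)) (2 * e i + 1)) \<le> 2 * n - 1"
    using assms[of i] by (auto intro!: order_trans[OF degree_monom_le])
qed

lemma poly_nrho_eq_0_imp:
  assumes "range e = {..<m}" "degree p < 2 * m" "poly_nrho e p = 0"
  shows "p = 0"
proof (rule poly_eqI)
  fix k
  show "coeff p k = coeff 0 k"
  proof (cases "k < 2 * m")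
    case True
    then have "k div 2 \<in> range e" unfolding assms(1) by auto
    then obtain i where i: "k div 2 = e i" by blast
    have "coeff p (2 * e i) = 0" "coeff p (2 * e i + 1) = 0"
      using assms(3) by (simp_all add: poly_nrho_def vec_eq_iff zero_prod_def)
    moreover have "k = 2 * e i \<or> k = 2 * e i + 1"
      using i by presburger
    ultimately show ?thesis by auto
  next
    case False
    then show ?thesis using assms(2) by (simp add: coeff_eq_0)
  qed
qed

text \<open>Multiplication has no zero divisors because the polynomial ring has none, provided that
  no coefficient of a product is cut off: \<open>2 (2n - 1) < 2m\<close>.\<close>

lemma nrho_mult_nonsingular:
  fixes e :: "'n::finite \<Rightarrow> nat" and h :: "'m::finite \<Rightarrow> nat"
  assumes "bij_betw e UNIV {..<n}" "bij_betw h UNIV {..<m}" "2 * n \<le> m"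
    and "nrho_mult e h x y = 0"
  shows "x = 0 \<or> y = 0"
proof -
  have e: "inj e" "\<And>i. e i < n" and h: "range h = {..<m}"
    using assms(1,2) by (auto simp: bij_betw_def)
  have "degree (nrho_poly e x * nrho_poly e y) \<le> (2 * n - 1) + (2 * n - 1)"
    by (intro order_trans[OF degree_mult_le] add_mono degree_nrho_poly e(2))
  also have "\<dots> < 2 * m" using assms(3) e(2)[of undefined] by linarith
  finally have "nrho_poly e x * nrho_poly e y = 0"
    using poly_nrho_eq_0_imp[OF h] assms(4) unfolding nrho_mult_def by blast
  then have "nrho_poly e x = 0 \<or> nrho_poly e y = 0" by simp
  moreover have "z = 0" if "nrho_poly e z = 0" for z
  proof -
    have "z = poly_nrho e 0" using poly_nrho_nrho_poly[OF e(1), of z] that by simp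
    then show ?thesis by (simp add: poly_nrho_def vec_eq_iff zero_prod_def)
  qed
  ultimately show ?thesis by blast
qed

section \<open>The growth of the exponent\<close>

lemma phi_0: "phi 0 = 0"
proof -
  have "{s::nat. 0 < s \<and> s \<le> 0 \<and> s mod 8 \<in> {0, 1, 2, 4}} = {}" by auto
  then show ?thesis unfolding phi_def by (metis card.empty)
qed

lemma phi_Suc: "phi (Suc k) = phi k + (if Suc k mod 8 \<in> {0, 1, 2, 4} then 1 else 0)"
proof -
  let ?P = "\<lambda>s::nat. s mod 8 \<in> {0, 1, 2, 4}"
  have "{s. 0 < s \<and> s \<le> Suc k \<and> ?P s} =
      (if ?P (Suc k) then insert (Suc k) {s. 0 < s \<and> s \<le> k \<and> ?P s}
       else {s. 0 < s \<and> s \<le> k \<and> ?P s})"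
    by (auto simp: le_Suc_eq)
  then show ?thesis by (simp add: phi_def)
qed

lemma phi_add_8: "phi (k + 8) = phi k + 4"
proof -
  define c :: "nat \<Rightarrow> nat" where "c s = (if s mod 8 \<in> {0, 1, 2, 4} then 1 else 0)" for s
  have step: "phi (Suc j) = phi j + c (Suc j)" for j
    by (simp add: phi_Suc c_def)
  have "phi (k + 8) = phi k + (c (k + 1) + c (k + 2) + c (k + 3) + c (k + 4) +
      c (k + 5) + c (k + 6) + c (k + 7) + c (k + 8))"
    by (simp add: numeral_eq_Suc step)
  moreover have "c (k + 1) + c (k + 2) + c (k + 3) + c (k + 4) +
      c (k + 5) + c (k + 6) + c (k + 7) + c (k + 8) = 4"
  proof -
    define r where "r = k mod 8"
    have shift: "c (k + j) = c (r + j)" for j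
      by (simp add: c_def r_def mod_add_left_eq)
    have "r < 8" by (simp add: r_def)
    then have "r = 0 \<or> r = 1 \<or> r = 2 \<or> r = 3 \<or> r = 4 \<or> r = 5 \<or> r = 6 \<or> r = 7"
      by presburger
    then show ?thesis unfolding shift by (elim disjE) (simp_all add: c_def)
  qed
  ultimately show ?thesis by simp
qed

lemma double_le_two_power_phi:
  assumes "n \<ge> 1" shows "2 * n \<le> 2 ^ phi (2 * n - 1)"
  using assms
proof (induction n rule: less_induct)
  case (less n)
  show ?case
  proof (cases "n \<le> 4")
    case True
    with less.prems have "n = 1 \<or> n = 2 \<or> n = 3 \<or> n = 4" by presburger
    moreover have "phi 1 = 1" "phi 2 = 2"
      using phi_0 phi_Suc[of 0] phi_Suc[of 1] by (simp_all add: numeral_2_eq_2)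
    moreover from this have "phi 3 = 2" "phi 5 = 3" "phi 7 = 3"
      using phi_Suc[of 2] phi_Suc[of 3] phi_Suc[of 4] phi_Suc[of 5] phi_Suc[of 6] by simp_all
    ultimately show ?thesis by (elim disjE) simp_all
  next
    case False
    then have "2 * (n - 4) \<le> 2 ^ phi (2 * (n - 4) - 1)"
      by (intro less.IH) auto
    moreover have "2 * n - 1 = (2 * (n - 4) - 1) + 8" using False by auto
    then have "phi (2 * n - 1) = phi (2 * (n - 4) - 1) + 4" by (metis phi_add_8)
    then have "(2::nat) ^ phi (2 * n - 1) = 16 * 2 ^ phi (2 * (n - 4) - 1)"
      by (simp only: power_add) simp
    ultimately show ?thesis using False by linarith
  qed
qed

section \<open>The immersion\<close>

theorem theorem1:
  fixes n :: nat
  assumes "n \<ge> 1"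
    and "CARD('n::finite) = n"
    and "CARD('k::finite) = 2 * n - 1"
    and "CARD('m::finite) = 2 ^ phi (2 * n - 1)"
  shows "\<exists>f :: 'n nrho set \<Rightarrow> 'm nrho.
    C2_immersion proj_space (proj_atlas :: ('n nrho set, real ^ 'k) chart set)
      (proj_act nrho_act) nrho_act f"
proof -
  obtain e :: "'n \<Rightarrow> nat" where e: "bij_betw e UNIV {..<n}"
    using ex_bij_betw_finite_nat[of "UNIV :: 'n set"] assms(2) by (metis atLeast0LessThan finite)
  obtain h :: "'m \<Rightarrow> nat" where h: "bij_betw h UNIV {..<CARD('m)}"
    using ex_bij_betw_finite_nat[of "UNIV :: 'm set"] by (metis atLeast0LessThan finite)
  have le: "2 * n \<le> CARD('m)"
    using double_le_two_power_phi assms(1,4) by simp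
  have "C2_immersion proj_space (proj_atlas :: ('n nrho set, real ^ 'k) chart set)
      (proj_act nrho_act) nrho_act (proj_square (nrho_mult e h :: _ \<Rightarrow> _ \<Rightarrow> 'm nrho))"
  proof (rule C2_immersion_proj_square)
    show "DIM('n nrho) = Suc DIM(real ^ 'k)" using assms by simp
    show "nrho_mult e h x y = nrho_mult e h y x" for x y
      by (simp add: nrho_mult_def mult.commute)
  qed (rule C2_representation_nrho_act norm_nrho_act bilinear_nrho_mult nrho_mult_equivariant
      nrho_mult_nonsingular[OF e h le] | assumption)+
  then show ?thesis by blast
qed

end
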